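(* Let $(c_n)\in\ell^2_{\mathbb{R}}$ and let $F_{(c_n)}:\Delta\to\mathbb{R}$, $F_{(c_n)}((p_n))=\langle(c_n),(p_n)\rangle_{\ell^2}$. Let $t\mapsto(p_n)(t)$ be a gradient flow line of $F_{(c_n)}$ on $(\Delta,\mathcal{G}^{\mathrm{FR}})$ with initial value $(p_n)(0)=(p_n)_0\in\Delta$. Then, for all $n\in\mathbb{N}$ and all $t\in[0,\infty)$, the components of $(p_n)(t)$ are given by $$p_n(t)=\frac{p_n(0)e^{c_nt}}{\sum_{k=0}^{\infty}p_k(0)e^{c_kt}}.$$ If, in addition, the sequence $(c_n)$ is strictly monotonically decreasing, then the limit $$p_{\max}:=\lim_{t\to\infty}(p_n)(t)$$ exists and is a solution of the linear programming problem $$\max_{(p_n)\in\bar\Delta}\langle(c_n),(p_n)\rangle_{\ell^2}.$$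
   Context: $\ell^2_{\mathbb{R}}$ is the real Hilbert space of square-summable real sequences $(x_n)_{n\in\mathbb{N}}$ (indices start at $0$), with inner product $\langle(x_n),(y_n)\rangle_{\ell^2}=\sum_{n=0}^\infty x_ny_n$; $\mathbb{S}(\ell^2_{\mathbb{R}})$ is its unit sphere and $\mathcal{U}:=\{(x_n)\in\mathbb{S}(\ell^2_{\mathbb{R}}):x_n>0\ \forall n\in\mathbb{N}\}$, regarded as an open subset of the sphere. The $\ell^2$-probability simplex is $\Delta:=\{(p_n)\in\ell^1_{\mathbb{R}}:\sum_{n=0}^\infty p_n=1,\ p_n>0\ \forall n\in\mathbb{N}\}$, equipped with the differentiable structure for which the homeomorphism $\Phi:\Delta\to\mathcal{U}$, $(p_n)\mapsto(\sqrt{p_n})$, becomes a diffeomorphism. With respect to it, $$T_{(p_n)}\Delta=\Big\{(v_n)\in\ell^1_{\mathbb{R}}:\sum_{n=0}^\infty v_n=0\ \text{and}\ \Big(\tfrac{v_n}{\sqrt{p_n}}\Big)\in\ell^2_{\mathbb{R}}\Big\}.$$ The $\ell^2$-Fisher--Rao metric is $$\mathcal{G}^{\mathrm{FR}}_{(p_n)}((v_n),(w_n)):=\frac14\sum_{n=0}^\infty\frac{v_n\cdot w_n}{p_n},\qquad (v_n),(w_n)\in T_{(p_n)}\Delta.$$ A gradient flow line of $F_{(c_n)}$ on $(\Delta,\mathcal{G}^{\mathrm{FR}})$ is an integral curve of the gradient vector field of $F_{(c_n)}$ with respect to $\mathcal{G}^{\mathrm{FR}}$. $\bar\Delta=\{(p_n)\in\ell^1_{\mathbb{R}}:\sum_{n=0}^\infty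 p_n=1,\ p_n\ge0\ \forall n\in\mathbb{N}\}$ is the closure of $\Delta$; the square-root map extends to a homeomorphism from $\bar\Delta$ onto the closure of $\mathcal{U}$ in $\mathbb{S}(\ell^2_{\mathbb{R}})$, and the limit is taken in this topology.
   Formalization: The exponents are 4c_n t and 4c_k t instead of c_n t and c_k t: with the factor 1/4 in the metric the gradient of F has components 4p_n(c_n − ⟨c,p⟩), so the printed formula fails for every nonzero (c_n). *)

theory Defs
  imports "HOL-Analysis.Analysis"
begin

section \<open>The spaces of absolutely and square-summable real sequences\<close>

definition l1_seqs :: "(nat \<Rightarrow> real) set" where
  "l1_seqs = {x. summable (\<lambda>n. \<bar>x n\<bar>)}"

definition l2_seqs :: "(nat \<Rightarrow> real) set" where
  "l2_seqs = {x. summable (\<lambda>n. (x n)\<^sup>2)}"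

lemma l2_seqs_mult_summable_abs:
  assumes "x \<in> l2_seqs" "y \<in> l2_seqs"
  shows "summable (\<lambda>n. \<bar>x n * y n\<bar>)"
proof (rule summable_comparison_test')
  show "summable (\<lambda>n. (x n)\<^sup>2 + (y n)\<^sup>2)"
    using assms by (auto simp: l2_seqs_def intro: summable_add)
  fix n :: nat
  have "2 * \<bar>x n\<bar> * \<bar>y n\<bar> \<le> (x n)\<^sup>2 + (y n)\<^sup>2"
    using sum_squares_bound[of "\<bar>x n\<bar>" "\<bar>y n\<bar>"] by simp
  moreover have "0 \<le> \<bar>x n\<bar> * \<bar>y n\<bar>"
    by simp
  ultimately show "norm \<bar>x n * y n\<bar> \<le> (x n)\<^sup>2 + (y n)\<^sup>2"
    unfolding real_norm_def abs_abs abs_mult by linarith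
qed

lemma l2_seqs_mult_summable:
  "x \<in> l2_seqs \<Longrightarrow> y \<in> l2_seqs \<Longrightarrow> summable (\<lambda>n. x n * y n)"
  by (rule summable_rabs_cancel) (rule l2_seqs_mult_summable_abs)

lemma l2_seqs_zero: "(\<lambda>n. 0) \<in> l2_seqs"
  by (simp add: l2_seqs_def)

lemma l2_seqs_scale: "x \<in> l2_seqs \<Longrightarrow> (\<lambda>n. r * x n) \<in> l2_seqs"
  by (auto simp: l2_seqs_def power_mult_distrib intro: summable_mult)

lemma l2_seqs_add:
  assumes "x \<in> l2_seqs" "y \<in> l2_seqs"
  shows "(\<lambda>n. x n + y n) \<in> l2_seqs"
proof -
  have "summable (\<lambda>n. (x n)\<^sup>2 + (y n)\<^sup>2 + 2 * (x n * y n))"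
    using assms l2_seqs_mult_summable[OF assms]
    by (intro summable_add summable_mult) (auto simp: l2_seqs_def)
  then show ?thesis
    by (simp add: l2_seqs_def power2_sum mult.assoc)
qed

typedef ell2 = "l2_seqs"
  morphisms coord Abs_ell2
  using l2_seqs_zero by blast

lemma ell2_eqI: "(\<And>n. coord x n = coord y n) \<Longrightarrow> x = y"
  by (metis coord_inverse ext)

instantiation ell2 :: real_inner
begin

definition zero_ell2 :: ell2 where
  "0 = Abs_ell2 (\<lambda>n. 0)"

definition plus_ell2 :: "ell2 \<Rightarrow> ell2 \<Rightarrow> ell2" where
  "x + y = Abs_ell2 (\<lambda>n. coord x n + coord y n)"

definition uminus_ell2 :: "ell2 \<Rightarrow> ell2" where
  "- x = Abs_ell2 (\<lambda>n. - coord x n)"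

definition minus_ell2 :: "ell2 \<Rightarrow> ell2 \<Rightarrow> ell2" where
  "x - y = Abs_ell2 (\<lambda>n. coord x n - coord y n)"

definition scaleR_ell2 :: "real \<Rightarrow> ell2 \<Rightarrow> ell2" where
  "scaleR r x = Abs_ell2 (\<lambda>n. r * coord x n)"

definition inner_ell2 :: "ell2 \<Rightarrow> ell2 \<Rightarrow> real" where
  "inner x y = (\<Sum>n. coord x n * coord y n)"

definition norm_ell2 :: "ell2 \<Rightarrow> real" where
  "norm x = sqrt (inner x x)" for x :: ell2

definition sgn_ell2 :: "ell2 \<Rightarrow> ell2" where
  "sgn x = inverse (norm x) *\<^sub>R x" for x :: ell2

definition dist_ell2 :: "ell2 \<Rightarrow> ell2 \<Rightarrow> real" where
  "dist x y = norm (x - y)" for x y :: ell2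

definition uniformity_ell2 :: "(ell2 \<times> ell2) filter" where
  "uniformity = (INF e\<in>{0<..}. principal {(x :: ell2, y). dist x y < e})"

definition open_ell2 :: "ell2 set \<Rightarrow> bool" where
  "open U \<longleftrightarrow> (\<forall>x\<in>U. eventually (\<lambda>(x', y). x' = x \<longrightarrow> y \<in> U) uniformity)" for U :: "ell2 set"

lemma coord_zero: "coord 0 n = 0"
  by (simp add: zero_ell2_def Abs_ell2_inverse l2_seqs_zero)

lemma coord_add: "coord (x + y) n = coord x n + coord y n"
  by (simp add: plus_ell2_def Abs_ell2_inverse l2_seqs_add coord)

lemma coord_scaleR: "coord (r *\<^sub>R x) n = r * coord x n"
  by (simp add: scaleR_ell2_def Abs_ell2_inverse l2_seqs_scale coord)

lemma coord_uminus: "coord (- x) n = - coord x n"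
  using l2_seqs_scale[OF coord[of x], of "- 1"]
  by (simp add: uminus_ell2_def Abs_ell2_inverse)

lemma coord_diff: "coord (x - y) n = coord x n - coord y n"
  using l2_seqs_add[OF coord[of x] l2_seqs_scale[OF coord[of y], of "- 1"]]
  by (simp add: minus_ell2_def Abs_ell2_inverse)

lemmas coord_simps = coord_zero coord_add coord_scaleR coord_uminus coord_diff

instance
proof
  fix x y z :: ell2 and r s :: real and U :: "ell2 set"
  note sm = l2_seqs_mult_summable[OF coord coord]
  show "x + y + z = x + (y + z)" "x + y = y + x" "0 + x = x" "- x + x = 0" "x - y = x + - y"
    by (auto intro!: ell2_eqI simp: coord_simps)
  show "r *\<^sub>R (x + y) = r *\<^sub>R x + r *\<^sub>R y" "(r + s) *\<^sub>R x = r *\<^sub>R x + s *\<^sub>R x"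
    "r *\<^sub>R s *\<^sub>R x = (r * s) *\<^sub>R x" "1 *\<^sub>R x = x"
    by (auto intro!: ell2_eqI simp: coord_simps algebra_simps)
  show "sgn x = inverse (norm x) *\<^sub>R x" "dist x y = norm (x - y)"
    "uniformity = (INF e\<in>{0<..}. principal {(x :: ell2, y). dist x y < e})"
    "open U \<longleftrightarrow> (\<forall>x\<in>U. eventually (\<lambda>(x', y). x' = x \<longrightarrow> y \<in> U) uniformity)"
    "norm x = sqrt (inner x x)"
    by (fact sgn_ell2_def dist_ell2_def uniformity_ell2_def open_ell2_def norm_ell2_def)+
  show "inner x y = inner y x"
    by (simp add: inner_ell2_def mult.commute)
  show "inner (x + y) z = inner x z + inner y z"
    using suminf_add[OF sm[of x z] sm[of y z]]
    by (simp add: inner_ell2_def coord_simps algebra_simps)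
  show "inner (r *\<^sub>R x) y = r * inner x y"
    using suminf_mult[OF sm[of x y], of r]
    by (simp add: inner_ell2_def coord_simps algebra_simps)
  show "0 \<le> inner x x"
    unfolding inner_ell2_def by (intro suminf_nonneg sm) simp
  have "inner x x = 0 \<longleftrightarrow> (\<forall>n. coord x n * coord x n = 0)"
    unfolding inner_ell2_def by (intro suminf_eq_zero_iff sm) simp
  then show "inner x x = 0 \<longleftrightarrow> x = 0"
    by (auto intro!: ell2_eqI simp: coord_simps)
qed

end


section \<open>The simplex and its differentiable structure\<close>

definition prob_simplex :: "(nat \<Rightarrow> real) set" where
  "prob_simplex = {p \<in> l1_seqs. (\<Sum>n. p n) = 1 \<and> (\<forall>n. 0 < p n)}"

definition closed_prob_simplex :: "(nat \<Rightarrow> real) set" where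
  "closed_prob_simplex = {p \<in> l1_seqs. (\<Sum>n. p n) = 1 \<and> (\<forall>n. 0 \<le> p n)}"

definition pos_sphere :: "ell2 set" where
  "pos_sphere = {x \<in> sphere 0 1. \<forall>n. 0 < coord x n}"

definition sqrt_map :: "(nat \<Rightarrow> real) \<Rightarrow> ell2" where
  "sqrt_map p = Abs_ell2 (\<lambda>n. sqrt (p n))"

definition square_map :: "ell2 \<Rightarrow> nat \<Rightarrow> real" where
  "square_map x = (\<lambda>n. (coord x n)\<^sup>2)"

lemma coord_sqrt_map:
  assumes "p \<in> closed_prob_simplex"
  shows "coord (sqrt_map p) n = sqrt (p n)"
proof -
  have "summable p"
    using assms by (auto simp: closed_prob_simplex_def l1_seqs_def intro: summable_rabs_cancel)
  then have "(\<lambda>n. sqrt (p n)) \<in> l2_seqs"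
    using assms by (simp add: l2_seqs_def closed_prob_simplex_def)
  then show ?thesis
    by (simp add: sqrt_map_def Abs_ell2_inverse)
qed

lemma prob_simplex_subset_closed: "prob_simplex \<subseteq> closed_prob_simplex"
  by (auto simp: prob_simplex_def closed_prob_simplex_def less_imp_le)

lemma bij_betw_sqrt_map: "bij_betw sqrt_map prob_simplex pos_sphere"
  and square_map_sqrt_map: "p \<in> prob_simplex \<Longrightarrow> square_map (sqrt_map p) = p"
  and sqrt_map_square_map: "x \<in> pos_sphere \<Longrightarrow> sqrt_map (square_map x) = x"
proof -
  have c: "coord (sqrt_map p) n = sqrt (p n)" if "p \<in> prob_simplex" for p n
    using that prob_simplex_subset_closed coord_sqrt_map by blast
  show 1: "square_map (sqrt_map p) = p" if "p \<in> prob_simplex" for p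
    using that by (auto simp: square_map_def c prob_simplex_def less_imp_le)
  show 2: "sqrt_map (square_map x) = x" if "x \<in> pos_sphere" for x
    using that by (auto simp: sqrt_map_def square_map_def pos_sphere_def less_imp_le coord_inverse)
  have 3: "sqrt_map p \<in> pos_sphere" if "p \<in> prob_simplex" for p
    using that by (auto simp: pos_sphere_def c norm_ell2_def inner_ell2_def prob_simplex_def less_imp_le)
  have 4: "square_map x \<in> prob_simplex" if "x \<in> pos_sphere" for x
    using that coord[of x]
    by (auto simp: pos_sphere_def square_map_def norm_ell2_def inner_ell2_def prob_simplex_def
        l1_seqs_def l2_seqs_def power2_eq_square less_imp_neq[symmetric] simp flip: less_imp_neq)
  show "bij_betw sqrt_map prob_simplex pos_sphere"
    by (rule bij_betw_byWitness[where f' = square_map]) (use 1 2 3 4 in auto)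
qed

definition simplex_tangent :: "(nat \<Rightarrow> real) \<Rightarrow> (nat \<Rightarrow> real) set" where
  "simplex_tangent p =
    {v \<in> l1_seqs. (\<Sum>n. v n) = 0 \<and> (\<lambda>n. v n / sqrt (p n)) \<in> l2_seqs}"

text \<open>
  The differential of \<^const>\<open>sqrt_map\<close> at \<open>p\<close>, defined on \<^term>\<open>simplex_tangent p\<close>; it identifies
  a tangent vector of the simplex with a tangent vector of the sphere.
\<close>

definition sqrt_map_deriv :: "(nat \<Rightarrow> real) \<Rightarrow> (nat \<Rightarrow> real) \<Rightarrow> ell2" where
  "sqrt_map_deriv p v = Abs_ell2 (\<lambda>n. v n / (2 * sqrt (p n)))"

text \<open>
  Since \<^const>\<open>sqrt_map\<close> is declared to be a diffeomorphism onto \<^const>\<open>pos_sphere\<close>, differentiability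
  in the simplex means differentiability in \<^typ>\<open>ell2\<close> after transport by \<^const>\<open>sqrt_map\<close>.
  Although \<^const>\<open>pos_sphere\<close> has empty interior in the sphere, a derivative within it is determined
  on every vector orthogonal to the base point, that is on the image of \<^term>\<open>sqrt_map_deriv p\<close>:
  finitely supported orthogonal directions are velocities of curves in \<^const>\<open>pos_sphere\<close>, and they
  are dense among the orthogonal vectors.
\<close>

definition has_simplex_differential ::
  "((nat \<Rightarrow> real) \<Rightarrow> real) \<Rightarrow> ((nat \<Rightarrow> real) \<Rightarrow> real) \<Rightarrow> (nat \<Rightarrow> real) \<Rightarrow> bool" where
  "has_simplex_differential f D p \<longleftrightarrow>
    (\<exists>L. ((f \<circ> square_map) has_derivative L) (at (sqrt_map p) within pos_sphere) \<and>
         (\<forall>v\<in>simplex_tangent p. D v = L (sqrt_map_deriv p v)))"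

definition has_simplex_velocity ::
  "(real \<Rightarrow> nat \<Rightarrow> real) \<Rightarrow> (nat \<Rightarrow> real) \<Rightarrow> real \<Rightarrow> real set \<Rightarrow> bool" where
  "has_simplex_velocity p v t T \<longleftrightarrow>
    v \<in> simplex_tangent (p t) \<and>
    ((\<lambda>s. sqrt_map (p s)) has_vector_derivative sqrt_map_deriv (p t) v) (at t within T)"


section \<open>The Fisher--Rao metric and its gradient flow lines\<close>

text \<open>
  With the normalisation \<open>1/4\<close>, which makes \<^const>\<open>sqrt_map\<close> an isometry, the gradient at \<open>p\<close> of
  \<open>p \<mapsto> \<Sum>n. c n * p n\<close> has components \<open>4 * p n * (c n - (\<Sum>k. c k * p k))\<close>. The factor \<open>4\<close> appears in
  the exponents of the flow lines.
\<close>

definition fisher_rao :: "(nat \<Rightarrow> real) \<Rightarrow> (nat \<Rightarrow> real) \<Rightarrow> (nat \<Rightarrow> real) \<Rightarrow> real" where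
  "fisher_rao p v w = 1 / 4 * (\<Sum>n. v n * w n / p n)"

definition is_fisher_rao_gradient_field ::
  "((nat \<Rightarrow> real) \<Rightarrow> real) \<Rightarrow> ((nat \<Rightarrow> real) \<Rightarrow> nat \<Rightarrow> real) \<Rightarrow> bool" where
  "is_fisher_rao_gradient_field f V \<longleftrightarrow>
    (\<forall>p\<in>prob_simplex. V p \<in> simplex_tangent p \<and>
      (\<exists>D. has_simplex_differential f D p \<and>
           (\<forall>w\<in>simplex_tangent p. fisher_rao p (V p) w = D w)))"

definition is_integral_curve ::
  "((nat \<Rightarrow> real) \<Rightarrow> nat \<Rightarrow> real) \<Rightarrow> real set \<Rightarrow> (real \<Rightarrow> nat \<Rightarrow> real) \<Rightarrow> bool" where
  "is_integral_curve V T p \<longleftrightarrow>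
    (\<forall>t\<in>T. p t \<in> prob_simplex \<and> has_simplex_velocity p (V (p t)) t T)"

definition is_fisher_rao_flow_line ::
  "((nat \<Rightarrow> real) \<Rightarrow> real) \<Rightarrow> real set \<Rightarrow> (real \<Rightarrow> nat \<Rightarrow> real) \<Rightarrow> bool" where
  "is_fisher_rao_flow_line f T p \<longleftrightarrow>
    (\<exists>V. is_fisher_rao_gradient_field f V \<and> is_integral_curve V T p)"

definition linear_functional :: "(nat \<Rightarrow> real) \<Rightarrow> (nat \<Rightarrow> real) \<Rightarrow> real" where
  "linear_functional c p = (\<Sum>n. c n * p n)"

end

theory Submission
  imports Defs
begin

text \<open>
  Testing the gradient equation against \<open>e\<^sub>i - e\<^sub>j\<close>, the velocity at \<open>p\<close> of the segment
  \<open>s \<mapsto> p + s (e\<^sub>i - e\<^sub>j)\<close> inside the simplex, gives \<open>V\<^sub>i / p\<^sub>i - V\<^sub>j / p\<^sub>j = 4 (c\<^sub>i - c\<^sub>j)\<close>. Along a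
  flow line this is the logarithmic derivative of \<open>p\<^sub>i / p\<^sub>j\<close>, which determines all the ratios, and
  \<open>\<Sum>n. p\<^sub>n = 1\<close> then determines \<open>p\<close>. If \<open>c\<close> is decreasing, the ratios force the mass
  onto the coordinate \<open>0\<close>, where the linear functional is maximal.
\<close>

section \<open>Coordinates and unit vectors\<close>

text \<open>These sequences serve twice: as vertices of the closed simplex and, in differences, as
  tangent vectors with finite support.\<close>

definition unit_seq :: "nat \<Rightarrow> nat \<Rightarrow> real" where
  "unit_seq i n = (if n = i then 1 else 0)"

lemma unit_seq_mult_sums: "(\<lambda>n. a n * unit_seq i n) sums a i"
  using sums_single[of i a] by (simp add: unit_seq_def if_distrib cong: if_cong)

lemma unit_seq_sums: "unit_seq i sums 1"
  using unit_seq_mult_sums[of "\<lambda>_. 1" i] by simp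

lemma unit_seq_closed_prob_simplex: "unit_seq i \<in> closed_prob_simplex"
proof -
  have "(\<lambda>n. \<bar>unit_seq i n\<bar>) = unit_seq i"
    by (auto simp: unit_seq_def)
  then show ?thesis
    using unit_seq_sums[of i]
    by (auto simp: closed_prob_simplex_def l1_seqs_def sums_iff unit_seq_def)
qed

lemma linear_functional_unit_seq: "linear_functional c (unit_seq i) = c i"
  using unit_seq_mult_sums[of c i] by (simp add: linear_functional_def sums_iff)

lemma unit_seq_diff_mult_sums: "(\<lambda>n. a n * (unit_seq i n - unit_seq j n)) sums (a i - a j)"
  using sums_diff[OF unit_seq_mult_sums unit_seq_mult_sums, of a i a j]
  by (simp add: right_diff_distrib)

text \<open>The entries 0 and 1 are fixed by the square root, so the vertices become the standard
  basis vectors of \<open>ell2\<close>.\<close>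

lemma coord_sqrt_map_unit_seq: "coord (sqrt_map (unit_seq i)) n = unit_seq i n"
  by (simp add: coord_sqrt_map unit_seq_closed_prob_simplex) (simp add: unit_seq_def)

lemma abs_coord_le_norm: "\<bar>coord x n\<bar> \<le> norm x"
proof -
  have "sum (\<lambda>k. coord x k * coord x k) {n} \<le> (\<Sum>k. coord x k * coord x k)"
    by (intro sum_le_suminf l2_seqs_mult_summable coord) auto
  then have "(coord x n)\<^sup>2 \<le> (norm x)\<^sup>2"
    unfolding power2_norm_eq_inner by (simp add: inner_ell2_def power2_eq_square)
  then show ?thesis
    using abs_le_square_iff[of "coord x n" "norm x"] by simp
qed

text \<open>This allows derivatives of curves in \<open>ell2\<close> to be read off coordinate by
  coordinate.\<close>

lemma bounded_linear_coord: "bounded_linear (\<lambda>x. coord x n)"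
  by (rule bounded_linear_intro[where K = 1])
    (simp_all add: coord_add coord_scaleR abs_coord_le_norm)

section \<open>Bounds and summability on the simplex\<close>

lemma closed_prob_simplexD:
  assumes "p \<in> closed_prob_simplex"
  shows "p sums 1" "0 \<le> p n"
  using assms summable_rabs_cancel[of p]
  by (auto simp: closed_prob_simplex_def l1_seqs_def sums_iff)

lemma prob_simplexD:
  assumes "p \<in> prob_simplex"
  shows "p sums 1" "0 < p n"
  using assms closed_prob_simplexD(1)[of p] prob_simplex_subset_closed
  by (auto simp: prob_simplex_def)

lemma prob_simplexI:
  assumes "p sums 1" "\<And>n. 0 < p n"
  shows "p \<in> prob_simplex"
  using assms by (simp add: prob_simplex_def l1_seqs_def sums_iff abs_of_pos)

lemma closed_prob_simplex_le_1:
  assumes "p \<in> closed_prob_simplex"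
  shows "p n \<le> 1"
proof -
  have "sum p {n} \<le> suminf p"
    using assms by (intro sum_le_suminf) (auto intro: sums_summable closed_prob_simplexD)
  then show ?thesis
    using closed_prob_simplexD(1)[OF assms] by (simp add: sums_iff)
qed

text \<open>Entries lie in [0,1], hence squaring decreases them. This makes the pairing with a
  square-summable \<open>c\<close> converge.\<close>

lemma closed_prob_simplex_l2:
  assumes "p \<in> closed_prob_simplex"
  shows "p \<in> l2_seqs"
proof -
  have "summable (\<lambda>n. (p n)\<^sup>2)"
  proof (rule summable_comparison_test')
    show "summable p"
      using closed_prob_simplexD(1)[OF assms] by (rule sums_summable)
    show "norm ((p n)\<^sup>2) \<le> p n" for n
      using mult_left_le[OF closed_prob_simplex_le_1 closed_prob_simplexD(2), OF assms assms]
      by (simp add: power2_eq_square)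
  qed
  then show ?thesis
    by (simp add: l2_seqs_def)
qed

lemma linear_functional_sums:
  assumes "c \<in> l2_seqs" "p \<in> closed_prob_simplex"
  shows "(\<lambda>n. c n * p n) sums linear_functional c p"
  unfolding linear_functional_def
  by (intro summable_sums l2_seqs_mult_summable assms closed_prob_simplex_l2)

lemma coord_sqrt_map_deriv:
  assumes "v \<in> simplex_tangent p"
  shows "coord (sqrt_map_deriv p v) n = v n / (2 * sqrt (p n))"
proof -
  have "(\<lambda>n. 1 / 2 * (v n / sqrt (p n))) \<in> l2_seqs"
    using assms by (intro l2_seqs_scale) (simp add: simplex_tangent_def)
  then show ?thesis
    by (simp add: sqrt_map_deriv_def Abs_ell2_inverse)
qed

section \<open>The gradient field\<close>

lemma unit_seq_diff_tangent: "(\<lambda>n. unit_seq i n - unit_seq j n) \<in> simplex_tangent p"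
proof -
  have fin: "summable (\<lambda>n. f n)" if "\<And>n. n \<notin> {i, j} \<Longrightarrow> f n = 0" for f :: "nat \<Rightarrow> real"
    using that by (intro summable_finite[of "{i, j}"]) auto
  have "(\<Sum>n. unit_seq i n - unit_seq j n) = 0"
    using unit_seq_diff_mult_sums[of "\<lambda>_. 1" i j] by (simp add: sums_iff)
  then show ?thesis
    by (auto simp: simplex_tangent_def l1_seqs_def l2_seqs_def unit_seq_def intro!: fin split: if_splits)
qed

lemma simplex_segment:
  assumes "p \<in> prob_simplex" "\<bar>s\<bar> < min (p i) (p j)"
  shows "(\<lambda>n. p n + s * (unit_seq i n - unit_seq j n)) \<in> prob_simplex"
proof (rule prob_simplexI)
  have "(\<lambda>n. p n + s * (unit_seq i n - unit_seq j n)) sums (1 + s * 0)"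
    using unit_seq_diff_mult_sums[of "\<lambda>_. 1" i j]
    by (intro sums_add sums_mult prob_simplexD assms) simp
  then show "(\<lambda>n. p n + s * (unit_seq i n - unit_seq j n)) sums 1"
    by simp
  fix n show "0 < p n + s * (unit_seq i n - unit_seq j n)"
    using assms(2) prob_simplexD(2)[OF assms(1), of n] by (auto simp: unit_seq_def)
qed

text \<open>The segment changes only two coordinates, so its image in \<open>ell2\<close> moves in
  the span of two fixed vectors and the derivative reduces to that of two real square roots.\<close>

lemma simplex_segment_velocity:
  assumes p: "p \<in> prob_simplex" and "i \<noteq> j"
  shows "((\<lambda>s. sqrt_map (\<lambda>n. p n + s * (unit_seq i n - unit_seq j n))) has_vector_derivative
    sqrt_map_deriv p (\<lambda>n. unit_seq i n - unit_seq j n)) (at 0)"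
proof -
  define E where "E k = sqrt_map (unit_seq k)" for k
  define S where "S = {s. \<bar>s\<bar> < min (p i) (p j)}"
  have pos: "0 < p n" for n
    using p by (rule prob_simplexD)
  have S: "open S" "0 \<in> S"
    unfolding S_def by (intro open_Collect_less continuous_intros) (simp add: pos)
  \<comment> \<open>A closed form of the transported segment; it agrees with the segment on
    \<open>S\<close>, where both moving coordinates stay positive. Distinct \<open>i\<close> and
    \<open>j\<close> keep the two corrections apart.\<close>
  define x where "x s = sqrt_map p + (sqrt (p i + s) - sqrt (p i)) *\<^sub>R E i
    + (sqrt (p j - s) - sqrt (p j)) *\<^sub>R E j" for s
  have "(x has_vector_derivative
      ((1 / (2 * sqrt (p i))) *\<^sub>R E i + (- (1 / (2 * sqrt (p j)))) *\<^sub>R E j)) (at 0)"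
    unfolding x_def using pos[of i] pos[of j]
    by (auto intro!: derivative_eq_intros simp: field_simps)
  also have "(1 / (2 * sqrt (p i))) *\<^sub>R E i + (- (1 / (2 * sqrt (p j)))) *\<^sub>R E j
      = sqrt_map_deriv p (\<lambda>n. unit_seq i n - unit_seq j n)"
    by (rule ell2_eqI)
      (simp add: coord_simps E_def coord_sqrt_map_unit_seq
        coord_sqrt_map_deriv[OF unit_seq_diff_tangent], auto simp: unit_seq_def)
  finally have x: "(x has_vector_derivative
    sqrt_map_deriv p (\<lambda>n. unit_seq i n - unit_seq j n)) (at 0)" .
  show ?thesis
  proof (rule has_vector_derivative_transform_within_open[OF x S])
    fix s assume "s \<in> S"
    then have seg: "(\<lambda>n. p n + s * (unit_seq i n - unit_seq j n)) \<in> closed_prob_simplex"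
      using simplex_segment[OF p] prob_simplex_subset_closed by (auto simp: S_def)
    show "x s = sqrt_map (\<lambda>n. p n + s * (unit_seq i n - unit_seq j n))"
    proof (rule ell2_eqI)
      have "p \<in> closed_prob_simplex"
        using p prob_simplex_subset_closed by blast
      then show "coord (x s) n
          = coord (sqrt_map (\<lambda>n. p n + s * (unit_seq i n - unit_seq j n))) n" for n
        unfolding coord_sqrt_map[OF seg] using \<open>i \<noteq> j\<close>
        by (simp add: x_def coord_simps E_def coord_sqrt_map_unit_seq coord_sqrt_map)
          (simp add: unit_seq_def)
    qed
  qed
qed

text \<open>\<open>D\<close> is only known through some derivative \<open>L\<close> within
  \<open>pos_sphere\<close>. Composing with the transported segment turns \<open>L\<close> into the
  derivative of an affine function of one real variable, whose slope is explicit.\<close>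

lemma simplex_differential_linear_functional:
  assumes c: "c \<in> l2_seqs" and p: "p \<in> prob_simplex" and "i \<noteq> j"
    and "has_simplex_differential (linear_functional c) D p"
  shows "D (\<lambda>n. unit_seq i n - unit_seq j n) = c i - c j"
proof -
  define w where "w = (\<lambda>n. unit_seq i n - unit_seq j n)"
  define q where "q s = (\<lambda>n. p n + s * w n)" for s
  obtain L where
    L: "((linear_functional c \<circ> square_map) has_derivative L) (at (sqrt_map p) within pos_sphere)"
    and D: "D w = L (sqrt_map_deriv p w)"
    using assms(4) unit_seq_diff_tangent[of i j p]
    by (auto simp: has_simplex_differential_def w_def)
  define S where "S = {s. \<bar>s\<bar> < min (p i) (p j)}"
  have S: "open S" "0 \<in> S"
    unfolding S_def
    by (intro open_Collect_less continuous_intros) (simp add: prob_simplexD(2)[OF p])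
  have q: "q s \<in> prob_simplex" if "s \<in> S" for s
    using simplex_segment[OF p] that by (simp add: q_def w_def S_def)
  have qd: "((\<lambda>s. sqrt_map (q s)) has_derivative (\<lambda>s. s *\<^sub>R sqrt_map_deriv p w)) (at 0 within S)"
    using simplex_segment_velocity[OF p \<open>i \<noteq> j\<close>]
    by (auto simp: q_def w_def has_vector_derivative_def intro: has_derivative_at_withinI)
  \<comment> \<open>The chain rule asks for the derivative within the image of the curve, so
    \<open>L\<close> is restricted to it.\<close>
  have "(\<lambda>s. sqrt_map (q s)) ` S \<subseteq> pos_sphere"
    using q bij_betw_sqrt_map by (auto simp: bij_betw_def)
  then have "((linear_functional c \<circ> square_map) has_derivative L)
      (at (sqrt_map (q 0)) within (\<lambda>s. sqrt_map (q s)) ` S)"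
    using has_derivative_subset[OF L] by (simp add: q_def)
  from diff_chain_within[OF qd this]
  have "((\<lambda>s. linear_functional c (square_map (sqrt_map (q s)))) has_derivative
      (\<lambda>s. L (s *\<^sub>R sqrt_map_deriv p w))) (at 0)"
    \<comment> \<open>As \<open>S\<close> is open, the derivative within it is a full one, to which
      uniqueness applies below.\<close>
    using at_within_open[OF S(2,1)] by (simp add: o_def)
  moreover have "linear_functional c (square_map (sqrt_map (q s)))
      = linear_functional c p + s * (c i - c j)" if "s \<in> S" for s
  proof -
    have "(\<lambda>n. c n * p n + s * (c n * w n)) sums (linear_functional c p + s * (c i - c j))"
      unfolding w_def using prob_simplex_subset_closed
      by (intro sums_add sums_mult unit_seq_diff_mult_sums linear_functional_sums[OF c] subsetD[OF _ p])
    then have "linear_functional c (q s) = linear_functional c p + s * (c i - c j)"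
      by (simp add: linear_functional_def q_def sums_iff algebra_simps)
    then show ?thesis
      by (simp add: square_map_sqrt_map q that)
  qed
  ultimately have "((\<lambda>s. linear_functional c p + s * (c i - c j)) has_derivative
      (\<lambda>s. L (s *\<^sub>R sqrt_map_deriv p w))) (at 0)"
    by (rule has_derivative_transform_within_open[OF _ S])
  moreover have "((\<lambda>s. linear_functional c p + s * (c i - c j)) has_derivative
      (\<lambda>s. s * (c i - c j))) (at 0)"
    by (auto intro!: derivative_eq_intros)
  ultimately have "(\<lambda>s. L (s *\<^sub>R sqrt_map_deriv p w)) = (\<lambda>s. s * (c i - c j))"
    by (rule has_derivative_unique)
  from fun_cong[OF this, of 1] show ?thesis
    using D by (simp add: w_def)
qed

text \<open>The factor 4 undoes the normalisation 1/4 of the metric. In the difference the mean of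
  \<open>c\<close> under \<open>p\<close>, common to all components of the gradient,
  cancels.\<close>

lemma gradient_field_ratio:
  assumes "c \<in> l2_seqs" "p \<in> prob_simplex"
    and "is_fisher_rao_gradient_field (linear_functional c) V"
  shows "V p i / p i - V p j / p j = 4 * (c i - c j)"
proof (cases "i = j")
  case False
  define w where "w = (\<lambda>n. unit_seq i n - unit_seq j n)"
  obtain D where "has_simplex_differential (linear_functional c) D p"
    and D: "fisher_rao p (V p) w = D w"
    using assms unit_seq_diff_tangent[of i j p]
    unfolding is_fisher_rao_gradient_field_def w_def by blast
  then have "fisher_rao p (V p) w = c i - c j"
    using simplex_differential_linear_functional[OF assms(1,2) False] by (simp add: w_def)
  moreover have "fisher_rao p (V p) w = 1 / 4 * (V p i / p i - V p j / p j)"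
    using unit_seq_diff_mult_sums[of "\<lambda>n. V p n / p n" i j]
    by (simp add: fisher_rao_def w_def sums_iff)
  ultimately show ?thesis
    by simp
qed simp

section \<open>Flow lines\<close>

text \<open>The velocity is given for the square roots in \<open>ell2\<close>; projecting to a
  coordinate and squaring recovers \<open>p\<close>, and the factor 2 times the root cancels the
  denominator of \<open>sqrt_map_deriv\<close>.\<close>

lemma integral_curve_component:
  assumes "is_integral_curve V T p" "t \<in> T"
  shows "((\<lambda>s. p s n) has_real_derivative V (p t) n) (at t within T)"
proof -
  have simplex: "p s \<in> prob_simplex" if "s \<in> T" for s
    using assms that by (auto simp: is_integral_curve_def)
  have c: "coord (sqrt_map (p s)) n = sqrt (p s n)" if "s \<in> T" for s
    using simplex[OF that] prob_simplex_subset_closed by (auto intro: coord_sqrt_map)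
  have pos: "0 < p s n" if "s \<in> T" for s
    using simplex[OF that] by (rule prob_simplexD)
  have V: "V (p t) \<in> simplex_tangent (p t)"
    and "((\<lambda>s. sqrt_map (p s)) has_vector_derivative sqrt_map_deriv (p t) (V (p t))) (at t within T)"
    using assms by (auto simp: is_integral_curve_def has_simplex_velocity_def)
  from bounded_linear.has_vector_derivative[OF bounded_linear_coord this(2)]
  have "((\<lambda>s. coord (sqrt_map (p s)) n) has_real_derivative V (p t) n / (2 * sqrt (p t n)))
      (at t within T)"
    by (simp add: coord_sqrt_map_deriv[OF V] has_real_derivative_iff_has_vector_derivative)
  then have "((\<lambda>s. (coord (sqrt_map (p s)) n)\<^sup>2) has_real_derivative
      2 * coord (sqrt_map (p t)) n * (V (p t) n / (2 * sqrt (p t n)))) (at t within T)"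
    by (auto intro!: derivative_eq_intros)
  moreover have "2 * coord (sqrt_map (p t)) n * (V (p t) n / (2 * sqrt (p t n))) = V (p t) n"
    using pos[OF \<open>t \<in> T\<close>] by (simp add: c[OF \<open>t \<in> T\<close>])
  ultimately have "((\<lambda>s. (coord (sqrt_map (p s)) n)\<^sup>2) has_real_derivative V (p t) n)
      (at t within T)"
    by simp
  then show ?thesis
    by (rule has_field_derivative_transform_within[OF _ zero_less_one \<open>t \<in> T\<close>])
      (simp add: c less_imp_le[OF pos])
qed

lemma flow_line_ratio:
  assumes c: "c \<in> l2_seqs"
    and flow: "is_fisher_rao_flow_line (linear_functional c) {0..} p"
    and "0 \<le> t"
  shows "p t i / p t j = p 0 i / p 0 j * exp (4 * (c i - c j) * t)"
proof -
  obtain V where V: "is_fisher_rao_gradient_field (linear_functional c) V"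
    and curve: "is_integral_curve V {0..} p"
    using flow by (auto simp: is_fisher_rao_flow_line_def)
  have simplex: "p s \<in> prob_simplex" if "0 \<le> s" for s
    using curve that by (auto simp: is_integral_curve_def)
  define k where "k = 4 * (c i - c j)"
  \<comment> \<open>An integrating factor: the ratio should satisfy y' = k y, so \<open>g\<close>
    should be constant.\<close>
  define g where "g s = p s i / p s j * exp (- k * s)" for s
  have "(g has_real_derivative 0) (at s within {0..})" if "s \<in> {0..}" for s
  proof -
    have pos: "0 < p s n" for n
      using simplex that by (auto intro: prob_simplexD)
    have "V (p s) i / p s i - V (p s) j / p s j = k"
      using gradient_field_ratio[OF c simplex V] that by (simp add: k_def)
    \<comment> \<open>The left side is the numerator that the quotient rule produces for the
      ratio.\<close>
    then have k: "V (p s) i * p s j - p s i * V (p s) j = k * (p s i * p s j)"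
      using pos[of i] pos[of j] by (simp add: field_simps)
    have "(g has_real_derivative
        (V (p s) i * p s j - p s i * V (p s) j) / (p s j * p s j) * exp (- k * s)
          + (exp (- k * s) * (- k)) * (p s i / p s j)) (at s within {0..})"
      unfolding g_def using pos[of j]
      by (intro DERIV_mult DERIV_divide integral_curve_component[OF curve that])
        (auto intro!: derivative_eq_intros)
    also have "(V (p s) i * p s j - p s i * V (p s) j) / (p s j * p s j) * exp (- k * s)
          + (exp (- k * s) * (- k)) * (p s i / p s j) = 0"
      unfolding k using pos[of j] by (simp add: field_simps)
    finally show ?thesis .
  qed
  then have "g t = g 0"
    using has_field_derivative_zero_constant[of "{0..}" g] \<open>0 \<le> t\<close> by force
  then have "p t i / p t j / exp (k * t) = p 0 i / p 0 j"
    by (simp add: g_def exp_minus divide_inverse)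
  then have "p t i / p t j = p 0 i / p 0 j * exp (k * t)"
    by (subst (asm) divide_eq_eq) simp
  then show ?thesis
    by (simp only: k_def)
qed

text \<open>By the ratios, the terms of the denominator are \<open>p t k\<close> times a factor
  independent of \<open>k\<close>. As \<open>p t\<close> sums to 1, the series converges and its sum
  is that factor.\<close>

lemma flow_line_explicit:
  assumes "c \<in> l2_seqs"
    and flow: "is_fisher_rao_flow_line (linear_functional c) {0..} p"
    and "0 \<le> t"
  shows "p t n = p 0 n * exp (4 * c n * t) / (\<Sum>k. p 0 k * exp (4 * c k * t))"
proof -
  have simplex: "p s \<in> prob_simplex" if "0 \<le> s" for s
    using flow that by (auto simp: is_fisher_rao_flow_line_def is_integral_curve_def)
  have pos: "0 < p t n" "0 < p 0 n"
    using simplex assms(3) by (auto intro: prob_simplexD)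
  define a where "a = p 0 n * exp (4 * c n * t)"
  have "p 0 k * exp (4 * c k * t) = a / p t n * p t k" for k
  proof -
    have "a / p t n * p t k = a * (p t k / p t n)"
      by simp
    also have "\<dots> = p 0 k * (exp (4 * c n * t) * exp (4 * (c k - c n) * t))"
      using flow_line_ratio[OF assms, of k n] pos by (simp add: a_def)
    also have "\<dots> = p 0 k * exp (4 * c k * t)"
      by (simp flip: exp_add) (simp add: algebra_simps)
    finally show ?thesis by simp
  qed
  moreover have "(\<lambda>k. a / p t n * p t k) sums (a / p t n * 1)"
    using simplex assms(3) by (intro sums_mult prob_simplexD) auto
  ultimately have "(\<Sum>k. p 0 k * exp (4 * c k * t)) = a / p t n"
    by (simp add: sums_iff)
  then show ?thesis
    using pos by (simp add: a_def)
qed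

section \<open>The limit\<close>

text \<open>Expanding the square of the difference of two unit vectors leaves only one cross term.
  Convergence to a vertex is thereby reduced to convergence of a single coordinate to 1.\<close>

lemma norm_sqrt_map_diff_unit_seq:
  assumes "p \<in> closed_prob_simplex"
  shows "norm (sqrt_map p - sqrt_map (unit_seq i)) = sqrt (2 - 2 * sqrt (p i))"
proof -
  have "(\<lambda>n. p n + unit_seq i n - 2 * (sqrt (p n) * unit_seq i n)) sums (1 + 1 - 2 * sqrt (p i))"
    by (intro sums_diff sums_add sums_mult unit_seq_mult_sums unit_seq_sums
        closed_prob_simplexD assms)
  moreover have "p n + unit_seq i n - 2 * (sqrt (p n) * unit_seq i n)
      = (sqrt (p n) - unit_seq i n) * (sqrt (p n) - unit_seq i n)" for n
    using closed_prob_simplexD(2)[OF assms, of n]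
    by (simp add: algebra_simps) (simp add: unit_seq_def)
  ultimately show ?thesis
    by (simp add: norm_eq_sqrt_inner inner_ell2_def coord_diff coord_sqrt_map assms
        coord_sqrt_map_unit_seq sums_iff)
qed

text \<open>The functional is a weighted average of the \<open>c n\<close>, hence at most
  \<open>c 0\<close>, and the vertex attains this bound.\<close>

lemma unit_seq_0_is_arg_max:
  assumes c: "c \<in> l2_seqs" and "\<And>n. c n \<le> c 0"
  shows "is_arg_max (linear_functional c) (\<lambda>q. q \<in> closed_prob_simplex) (unit_seq 0)"
proof -
  have "linear_functional c q \<le> c 0" if q: "q \<in> closed_prob_simplex" for q
  proof (rule sums_le[OF _ linear_functional_sums[OF c q]])
    show "c n * q n \<le> c 0 * q n" for n
      using assms(2) closed_prob_simplexD(2)[OF q] by (rule mult_right_mono)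
    show "(\<lambda>n. c 0 * q n) sums c 0"
      using sums_mult[OF closed_prob_simplexD(1)[OF q], of "c 0"] by simp
  qed
  then show ?thesis
    by (auto simp: is_arg_max_def unit_seq_closed_prob_simplex linear_functional_unit_seq not_less)
qed

text \<open>The gap \<open>d\<close> is uniform in \<open>n\<close>, so one exponential dominates
  all ratios to coordinate 0 at once, and summing bounds the mass elsewhere.\<close>

lemma flow_line_tendsto:
  assumes c: "c \<in> l2_seqs"
    and flow: "is_fisher_rao_flow_line (linear_functional c) {0..} p"
    and gap: "0 < d" "\<And>n. n \<noteq> 0 \<Longrightarrow> c n \<le> c 0 - d"
  shows "((\<lambda>t. sqrt_map (p t)) \<longlongrightarrow> sqrt_map (unit_seq 0)) at_top"
proof -
  have simplex: "p s \<in> prob_simplex" if "0 \<le> s" for s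
    using flow that by (auto simp: is_fisher_rao_flow_line_def is_integral_curve_def)
  have closed: "p s \<in> closed_prob_simplex" if "0 \<le> s" for s
    using simplex[OF that] prob_simplex_subset_closed by blast
  have lower: "1 - exp (- (4 * d) * t) / p 0 0 \<le> p t 0" if "0 \<le> t" for t
  proof -
    define b where "b = exp (- (4 * d) * t) / p 0 0"
    have pos: "0 < p s n" if "0 \<le> s" for s n
      using simplex[OF that] by (rule prob_simplexD)
    \<comment> \<open>The \<open>unit_seq\<close> term covers coordinate 0, so one summable bound
      serves every \<open>n\<close>; its sum is \<open>p t 0 + b\<close>, to be compared with total
      mass 1.\<close>
    have "p t n \<le> p t 0 * unit_seq 0 n + b * p 0 n" for n
    proof (cases "n = 0")
      case True
      then show ?thesis
        using pos[of 0 0] by (simp add: unit_seq_def b_def)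
    next
      case False
      have "exp (4 * (c n - c 0) * t) \<le> exp (- (4 * d) * t)"
        using gap(2)[OF False] that unfolding exp_le_cancel_iff by (intro mult_right_mono) auto
      moreover have "0 \<le> p 0 n / p 0 0"
        using pos[of 0 n] pos[of 0 0] by simp
      ultimately have "p 0 n / p 0 0 * exp (4 * (c n - c 0) * t)
          \<le> p 0 n / p 0 0 * exp (- (4 * d) * t)"
        by (rule mult_left_mono)
      \<comment> \<open>Since \<open>p t 0\<close> is at most 1, dividing by it can only
        enlarge.\<close>
      moreover have "p t n \<le> p t n / p t 0"
        using pos[OF that, of n] pos[OF that, of 0]
          closed_prob_simplex_le_1[OF closed[OF that], of 0]
        by (simp add: pos_le_divide_eq mult_left_le)
      ultimately have "p t n \<le> p 0 n / p 0 0 * exp (- (4 * d) * t)"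
        unfolding flow_line_ratio[OF c flow that, of n 0] by (rule order_trans[rotated])
      then show ?thesis
        using False by (simp add: unit_seq_def b_def mult.commute)
    qed
    moreover have "(\<lambda>n. p t 0 * unit_seq 0 n + b * p 0 n) sums (p t 0 * 1 + b * 1)"
      by (intro sums_add sums_mult unit_seq_sums prob_simplexD simplex order_refl)
    ultimately have "1 \<le> p t 0 * 1 + b * 1"
      by (rule sums_le[OF _ prob_simplexD(1)[OF simplex[OF that]]])
    then show ?thesis
      by (simp add: b_def)
  qed
  have "((\<lambda>t. exp (- (4 * d) * t)) \<longlongrightarrow> 0) at_top"
    using gap(1)
    by (intro filterlim_compose[OF exp_at_bot] filterlim_tendsto_neg_mult_at_bot[OF tendsto_const]
        filterlim_ident) auto
  then have "((\<lambda>t. 1 - exp (- (4 * d) * t) / p 0 0) \<longlongrightarrow> 1 - 0 / p 0 0) at_top"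
    using prob_simplexD(2)[OF simplex[OF order_refl], of 0] by (intro tendsto_intros) auto
  then have "((\<lambda>t. 1 - exp (- (4 * d) * t) / p 0 0) \<longlongrightarrow> 1) at_top"
    by simp
  then have "((\<lambda>t. p t 0) \<longlongrightarrow> 1) at_top"
  proof (rule tendsto_sandwich[OF _ _ _ tendsto_const, rotated 2])
    show "\<forall>\<^sub>F t in at_top. 1 - exp (- (4 * d) * t) / p 0 0 \<le> p t 0"
      using eventually_ge_at_top[of 0] by eventually_elim (rule lower)
    show "\<forall>\<^sub>F t in at_top. p t 0 \<le> 1"
      using eventually_ge_at_top[of 0]
      by eventually_elim (rule closed_prob_simplex_le_1[OF closed])
  qed
  then have "((\<lambda>t. sqrt (2 - 2 * sqrt (p t 0))) \<longlongrightarrow> sqrt (2 - 2 * sqrt 1)) at_top"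
    by (intro tendsto_intros)
  then have "((\<lambda>t. sqrt (2 - 2 * sqrt (p t 0))) \<longlongrightarrow> 0) at_top"
    by simp
  moreover have "\<forall>\<^sub>F t in at_top. sqrt (2 - 2 * sqrt (p t 0))
      = norm (sqrt_map (p t) - sqrt_map (unit_seq 0))"
    using eventually_ge_at_top[of 0]
    by eventually_elim (simp only: norm_sqrt_map_diff_unit_seq closed)
  ultimately have "((\<lambda>t. norm (sqrt_map (p t) - sqrt_map (unit_seq 0))) \<longlongrightarrow> 0) at_top"
    by (rule Lim_transform_eventually)
  then show ?thesis
    by (simp add: tendsto_norm_zero_iff LIM_zero_iff)
qed

text \<open>The 4 in the exponents comes from the factor 1/4 in \<open>fisher_rao\<close>. The limit
  is expressed through \<open>sqrt_map\<close> because the topology of the closed simplex is the one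
  transported from the sphere.\<close>

theorem proposition3p1:
  fixes c p0 :: "nat \<Rightarrow> real" and p :: "real \<Rightarrow> nat \<Rightarrow> real"
  assumes "c \<in> l2_seqs"
    and "p0 \<in> prob_simplex"
    and "is_fisher_rao_flow_line (linear_functional c) {0..} p"
    and "p 0 = p0"
  shows "(\<forall>n. \<forall>t\<ge>0. p t n = p 0 n * exp (4 * c n * t) / (\<Sum>k. p 0 k * exp (4 * c k * t))) \<and>
    ((\<forall>m n. m < n \<longrightarrow> c n < c m) \<longrightarrow>
      (\<exists>p_max \<in> closed_prob_simplex.
        ((\<lambda>t. sqrt_map (p t)) \<longlongrightarrow> sqrt_map p_max) at_top \<and>
        is_arg_max (linear_functional c) (\<lambda>q. q \<in> closed_prob_simplex) p_max))"
proof (intro conjI allI impI)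
  show "p t n = p 0 n * exp (4 * c n * t) / (\<Sum>k. p 0 k * exp (4 * c k * t))" if "0 \<le> t" for n t
    using assms(1,3) that by (rule flow_line_explicit)
next
  assume dec: "\<forall>m n. m < n \<longrightarrow> c n < c m"
  \<comment> \<open>In a decreasing sequence \<open>c 1\<close> is the largest value after
    \<open>c 0\<close>, which makes \<open>c 0 - c 1\<close> a uniform gap.\<close>
  have gap: "c n \<le> c 0 - (c 0 - c 1)" if "n \<noteq> 0" for n
    using dec that by (cases "n = 1") (auto simp: less_imp_le)
  have "c n \<le> c 0" for n
    using dec by (cases "n = 0") (auto simp: less_imp_le)
  with assms(1) have "is_arg_max (linear_functional c) (\<lambda>q. q \<in> closed_prob_simplex) (unit_seq 0)"
    by (rule unit_seq_0_is_arg_max)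
  moreover have "((\<lambda>t. sqrt_map (p t)) \<longlongrightarrow> sqrt_map (unit_seq 0)) at_top"
    using dec gap by (intro flow_line_tendsto[OF assms(1,3), of "c 0 - c 1"]) auto
  ultimately show "\<exists>p_max \<in> closed_prob_simplex.
      ((\<lambda>t. sqrt_map (p t)) \<longlongrightarrow> sqrt_map p_max) at_top \<and>
      is_arg_max (linear_functional c) (\<lambda>q. q \<in> closed_prob_simplex) p_max"
    using unit_seq_closed_prob_simplex by blast
qed

end
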